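(* Let $X$ be a Tychonoff space. Suppose there exists a sequence $(K_n)_{n\in\omega}$ of non-empty compact subsets of $X$ such that for every $n\in\omega$ the compact set $K_n$ contains two disjoint topological copies of $K_{n+1}$ (that is, two disjoint subspaces each homeomorphic to $K_{n+1}$). Then the space $C_p(X)$ has a metrizable infinite-dimensional quotient.
   Context: For a Tychonoff space $X$, $C_p(X)$ is the space of continuous real-valued functions on $X$ with the topology of pointwise convergence. A quotient of a topological vector space $E$ is a space $E/Z$ with the quotient topology, where $Z$ is a closed linear subspace of $E$. $\omega=\{0,1,2,\dots\}$. *)

theory Defs
  imports "HOL-Analysis.Analysis" "HOL-Library.Function_Algebras"
begin

text \<open>Function_Algebras supplies the pointwise additive group structure on functions;
  the pointwise scalar multiplication is added here.\<close>

instantiation "fun" :: (type, real_vector) real_vector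
begin

definition scaleR_fun_def: "c *\<^sub>R f = (\<lambda>x. c *\<^sub>R f x)"

instance
  by standard (simp_all add: scaleR_fun_def fun_eq_iff algebra_simps)

end


subsection \<open>The space of continuous functions with the topology of pointwise convergence\<close>

text \<open>Since \<open>X\<close> is a topology on an arbitrary carrier \<open>topspace X \<subseteq> UNIV\<close>, a function on the carrier is
  represented by its extension by zero. In this way the vector space operations are those of the
  type \<open>'a \<Rightarrow> real\<close>. The coordinates outside the carrier are constantly 0 and do not affect the
  topology; see \<open>homeomorphic_map_Cp\<close>.\<close>

definition Cp :: "'a topology \<Rightarrow> ('a \<Rightarrow> real) topology" where
  "Cp X = subtopology (powertop_real UNIV)
            {f. continuous_map X euclideanreal f \<and> (\<forall>x. x \<notin> topspace X \<longrightarrow> f x = 0)}"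

lemma topspace_Cp:
  "topspace (Cp X) = {f. continuous_map X euclideanreal f \<and> (\<forall>x. x \<notin> topspace X \<longrightarrow> f x = 0)}"
  by (simp add: Cp_def)

lemma subspace_topspace_Cp: "subspace (topspace (Cp X))"
  unfolding subspace_def topspace_Cp
  by (auto simp: scaleR_fun_def zero_fun_def plus_fun_def
           intro: continuous_map_add continuous_map_real_mult_left)

lemma homeomorphic_map_Cp:
  "homeomorphic_map (Cp X)
     (subtopology (powertop_real (topspace X)) {f. continuous_map X euclideanreal f})
     (\<lambda>f. restrict f (topspace X))"
proof -
  let ?P = "subtopology (powertop_real (topspace X)) {f. continuous_map X euclideanreal f}"
  let ?r = "\<lambda>f::'a \<Rightarrow> real. restrict f (topspace X)"
  let ?e = "\<lambda>(f::'a \<Rightarrow> real) x. if x \<in> topspace X then f x else 0"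
  have cm: "continuous_map X euclideanreal (?r f)" "continuous_map X euclideanreal (?e f)"
    if "continuous_map X euclideanreal f" for f :: "'a \<Rightarrow> real"
    by (rule continuous_map_eq[OF that]; simp)+
  have "continuous_map (Cp X) (powertop_real (topspace X)) ?r"
    unfolding continuous_map_componentwise Cp_def
    by (auto intro: continuous_map_from_subtopology continuous_map_product_projection)
  then have r: "continuous_map (Cp X) ?P ?r"
    using cm by (auto simp: continuous_map_in_subtopology topspace_Cp)
  have "continuous_map ?P euclideanreal (\<lambda>f. ?e f x)" for x
    by (cases "x \<in> topspace X")
      (auto intro: continuous_map_from_subtopology continuous_map_product_projection)
  then have "continuous_map ?P (powertop_real UNIV) ?e"
    by (simp add: continuous_map_componentwise_UNIV)
  then have e: "continuous_map ?P (Cp X) ?e"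
    using cm by (auto simp: continuous_map_in_subtopology Cp_def)
  have "homeomorphic_maps (Cp X) ?P ?r ?e"
    unfolding homeomorphic_maps_def
    using r e by (auto simp: topspace_Cp PiE_def extensional_def fun_eq_iff)
  then show ?thesis
    by (rule homeomorphic_maps_map[THEN iffD1, THEN conjunct1])
qed


subsection \<open>Quotients\<close>

text \<open>Here \<open>T\<close> is a vector topology on a linear subspace \<open>topspace T\<close> of a real vector space and
  \<open>Z\<close> is a linear subspace of \<open>topspace T\<close>.\<close>

definition vcoset :: "'v::real_vector set \<Rightarrow> 'v \<Rightarrow> 'v set" where
  "vcoset Z v = (\<lambda>z. v + z) ` Z"

definition quotient_set :: "'v::real_vector set \<Rightarrow> 'v set \<Rightarrow> 'v set set" where
  "quotient_set E Z = vcoset Z ` E"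

definition quotient_topology :: "'v::real_vector topology \<Rightarrow> 'v set \<Rightarrow> 'v set topology" where
  "quotient_topology T Z = topology (\<lambda>U. U \<subseteq> quotient_set (topspace T) Z \<and>
                                         openin T {v \<in> topspace T. vcoset Z v \<in> U})"

lemma openin_quotient_topology:
  "openin (quotient_topology T Z) U \<longleftrightarrow>
     U \<subseteq> quotient_set (topspace T) Z \<and> openin T {v \<in> topspace T. vcoset Z v \<in> U}"
proof -
  have "istopology (\<lambda>U. U \<subseteq> quotient_set (topspace T) Z \<and>
                        openin T {v \<in> topspace T. vcoset Z v \<in> U})"
    unfolding istopology_def
  proof (intro conjI allI impI; (elim conjE)?)
    fix S U
    assume "openin T {v \<in> topspace T. vcoset Z v \<in> S}" "openin T {v \<in> topspace T. vcoset Z v \<in> U}"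
    then have "openin T ({v \<in> topspace T. vcoset Z v \<in> S} \<inter> {v \<in> topspace T. vcoset Z v \<in> U})"
      by (rule openin_Int)
    then show "openin T {v \<in> topspace T. vcoset Z v \<in> S \<inter> U}"
      by (rule back_subst) auto
  next
    fix \<U>
    assume "\<forall>U\<in>\<U>. U \<subseteq> quotient_set (topspace T) Z \<and> openin T {v \<in> topspace T. vcoset Z v \<in> U}"
    then have "openin T (\<Union>U\<in>\<U>. {v \<in> topspace T. vcoset Z v \<in> U})"
      by auto
    then show "openin T {v \<in> topspace T. vcoset Z v \<in> \<Union>\<U>}"
      by (rule back_subst) auto
  qed auto
  then show ?thesis
    by (simp add: quotient_topology_def topology_inverse')
qed

lemma topspace_quotient_topology [simp]:
  "topspace (quotient_topology T Z) = quotient_set (topspace T) Z"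
proof -
  have "{v \<in> topspace T. vcoset Z v \<in> quotient_set (topspace T) Z} = topspace T"
    by (auto simp: quotient_set_def)
  then have "openin (quotient_topology T Z) (quotient_set (topspace T) Z)"
    by (simp add: openin_quotient_topology)
  then show ?thesis
    by (meson openin_quotient_topology openin_subset openin_topspace subset_antisym)
qed

lemma quotient_map_quotient_topology: "quotient_map T (quotient_topology T Z) (vcoset Z)"
  by (auto simp: quotient_map_def openin_quotient_topology quotient_set_def)

definition coset_add :: "'v::real_vector set \<Rightarrow> 'v set \<Rightarrow> 'v set" where
  "coset_add A B = {a + b | a b. a \<in> A \<and> b \<in> B}"

text \<open>The summand \<open>z\<close> matters for \<open>c = 0\<close> only, where the result has to be \<open>Z\<close>, not \<open>{0}\<close>.\<close>

definition coset_scale :: "'v::real_vector set \<Rightarrow> real \<Rightarrow> 'v set \<Rightarrow> 'v set" where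
  "coset_scale Z c A = {c *\<^sub>R a + z | a z. a \<in> A \<and> z \<in> Z}"

lemma coset_add_vcoset:
  assumes "subspace Z"
  shows "coset_add (vcoset Z v) (vcoset Z w) = vcoset Z (v + w)"
proof (intro set_eqI iffI)
  fix x assume "x \<in> coset_add (vcoset Z v) (vcoset Z w)"
  then obtain y z where "y \<in> Z" "z \<in> Z" "x = (v + y) + (w + z)"
    by (auto simp: coset_add_def vcoset_def)
  then have "x = (v + w) + (y + z)" "y + z \<in> Z"
    using assms by (auto simp: algebra_simps subspace_add)
  then show "x \<in> vcoset Z (v + w)"
    by (auto simp: vcoset_def)
next
  fix x assume "x \<in> vcoset Z (v + w)"
  then obtain z where "z \<in> Z" "x = (v + 0) + (w + z)"
    by (auto simp: vcoset_def algebra_simps)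
  then show "x \<in> coset_add (vcoset Z v) (vcoset Z w)"
    using subspace_0[OF assms] unfolding coset_add_def vcoset_def by blast
qed

lemma coset_scale_vcoset:
  assumes "subspace Z"
  shows "coset_scale Z c (vcoset Z v) = vcoset Z (c *\<^sub>R v)"
proof (intro set_eqI iffI)
  fix x assume "x \<in> coset_scale Z c (vcoset Z v)"
  then obtain y z where "y \<in> Z" "z \<in> Z" "x = c *\<^sub>R (v + y) + z"
    by (auto simp: coset_scale_def vcoset_def)
  then have "x = c *\<^sub>R v + (c *\<^sub>R y + z)" "c *\<^sub>R y + z \<in> Z"
    using assms by (auto simp: algebra_simps subspace_add subspace_scale)
  then show "x \<in> vcoset Z (c *\<^sub>R v)"
    by (auto simp: vcoset_def)
next
  fix x assume "x \<in> vcoset Z (c *\<^sub>R v)"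
  then obtain z where "z \<in> Z" "x = c *\<^sub>R (v + 0) + z"
    by (auto simp: vcoset_def)
  then show "x \<in> coset_scale Z c (vcoset Z v)"
    using subspace_0[OF assms] unfolding coset_scale_def vcoset_def by blast
qed

text \<open>The linear span, in the quotient space by \<open>Z\<close>, of a set \<open>S\<close> of cosets. The coset \<open>Z\<close> is the
  zero vector of the quotient.\<close>

inductive_set quotient_span :: "'v::real_vector set \<Rightarrow> 'v set set \<Rightarrow> 'v set set"
  for Z :: "'v set" and S :: "'v set set" where
  zero: "Z \<in> quotient_span Z S"
| add_scale: "A \<in> S \<Longrightarrow> B \<in> quotient_span Z S \<Longrightarrow>
    coset_add (coset_scale Z c A) B \<in> quotient_span Z S"

definition infinite_dimensional_quotient :: "'v::real_vector set \<Rightarrow> 'v set \<Rightarrow> bool" where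
  "infinite_dimensional_quotient E Z \<longleftrightarrow>
     (\<nexists>S. finite S \<and> S \<subseteq> quotient_set E Z \<and> quotient_span Z S = quotient_set E Z)"

lemma quotient_span_vcoset:
  assumes "subspace Z"
  shows "quotient_span Z (vcoset Z ` B) = vcoset Z ` span B"
proof (intro set_eqI iffI)
  have Z: "Z = vcoset Z 0"
    by (simp add: vcoset_def)
  fix A
  {
    assume "A \<in> quotient_span Z (vcoset Z ` B)"
    then show "A \<in> vcoset Z ` span B"
    proof induction
      case zero
      show ?case
        using Z span_zero by blast
    next
      case (add_scale A C c)
      then obtain b v where "b \<in> B" "A = vcoset Z b" "v \<in> span B" "C = vcoset Z v"
        by blast
      then show ?case
        by (simp add: assms coset_add_vcoset coset_scale_vcoset span_add span_base span_scale)
    qed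
  next
    assume "A \<in> vcoset Z ` span B"
    then obtain v where v: "v \<in> span B" "A = vcoset Z v"
      by blast
    from v(1) have "vcoset Z v \<in> quotient_span Z (vcoset Z ` B)"
    proof (induction rule: span_induct_alt)
      case base
      show ?case
        using Z quotient_span.zero by metis
    next
      case (step c b w)
      then have "coset_add (coset_scale Z c (vcoset Z b)) (vcoset Z w)
                   \<in> quotient_span Z (vcoset Z ` B)"
        by (blast intro: quotient_span.add_scale)
      then show ?case
        by (simp add: assms coset_add_vcoset coset_scale_vcoset)
    qed
    then show "A \<in> quotient_span Z (vcoset Z ` B)"
      using v(2) by simp
  }
qed

end

theory Submission
  imports Defs
begin

text \<open>Iterating the two embeddings \<open>K (n+1) \<rightarrow> K n\<close> gives \<open>2 ^ n\<close> disjoint copies of \<open>K n\<close> in \<open>K 0\<close>. For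
  \<open>f \<in> C\<^sub>p(X)\<close> let \<open>S\<^sub>n f\<close> be the function on \<open>K n\<close> that sums \<open>f\<close> over the copies; if \<open>S\<^sub>n f = 0\<close> then
  \<open>S\<^sub>m f = 0\<close> for all \<open>m \<ge> n\<close>. Choose \<open>p\<^sub>n \<in> K n\<close> and let \<open>Z\<close> be the common kernel of the functionals
  \<open>\<phi>\<^sub>k f = (S\<^sub>2\<^sub>k f) p\<^sub>2\<^sub>k\<close>, the sums over sets of \<open>4 ^ k\<close> points. The key fact is that the condition
  \<open>S\<^sub>n f = 0\<close> does not restrict the values of \<open>f\<close> on a set of fewer than \<open>2 ^ n\<close> points: any such value
  can be compensated in another copy at a point outside the set. The supports of \<open>\<phi>\<^sub>0, \<dots>, \<phi>\<^sub>k\<^sub>-\<^sub>1\<close> have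
  at most \<open>(4 ^ k - 1) / 3\<close> points together. This leaves room for one further point, which gives a
  sequence biorthogonal to \<open>\<phi>\<close>; for \<open>k\<close> large it also leaves room for a given finite set \<open>F\<close>, so that
  modulo \<open>Z\<close> the restriction of \<open>f\<close> to \<open>F\<close> is a continuous function of \<open>\<phi>\<^sub>0 f, \<dots>, \<phi>\<^sub>k\<^sub>-\<^sub>1 f\<close>. Hence
  \<open>f \<mapsto> (\<phi>\<^sub>k f)\<^sub>k\<close> is open onto
  its image in \<open>\<real>\<^sup>\<omega>\<close>, and the quotient by \<open>Z\<close> is homeomorphic to that image.\<close>

section \<open>Quotients by the common kernel of a sequence of functionals\<close>

text \<open>A finite spanning set of cosets lifts to a finite \<open>B\<close>. Modulo
  \<open>Z\<close> each \<open>e j\<close> agrees with some \<open>b j\<close> in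
  \<open>span B\<close>; biorthogonality passes to the \<open>b j\<close> and makes them infinitely
  many independent vectors in a finitely generated span.\<close>

lemma infinite_dimensional_quotientI:
  fixes E Z :: "'v::real_vector set" and e :: "nat \<Rightarrow> 'v" and \<phi> :: "nat \<Rightarrow> 'v \<Rightarrow> real"
  assumes "subspace E" "subspace Z" "\<And>k. linear (\<phi> k)" "\<And>k z. z \<in> Z \<Longrightarrow> \<phi> k z = 0"
    and e: "\<And>j. e j \<in> E" and dual: "\<And>i j. \<phi> i (e j) = (if i = j then 1 else 0)"
  shows "infinite_dimensional_quotient E Z"
  unfolding infinite_dimensional_quotient_def
proof
  assume "\<exists>S. finite S \<and> S \<subseteq> quotient_set E Z \<and> quotient_span Z S = quotient_set E Z"
  then obtain S where S: "finite S" "S \<subseteq> vcoset Z ` E" "quotient_span Z S = vcoset Z ` E"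
    by (auto simp: quotient_set_def)
  obtain B where B: "finite B" "S = vcoset Z ` B"
    using finite_subset_image[OF S(1,2)] by blast
  have "\<exists>b. b \<in> span B \<and> (\<forall>i. \<phi> i b = \<phi> i (e j))" for j
  proof -
    have "vcoset Z ` span B = vcoset Z ` E"
      using S(3) by (simp add: B(2) quotient_span_vcoset[OF assms(2)])
    then have "vcoset Z (e j) \<in> vcoset Z ` span B"
      using e by simp
    then obtain b where b: "b \<in> span B" "vcoset Z (e j) = vcoset Z b"
      by blast
    have "e j + 0 \<in> vcoset Z b"
      using b(2) subspace_0[OF assms(2)] unfolding vcoset_def by blast
    then obtain z where "z \<in> Z" "e j = b + z"
      by (auto simp: vcoset_def)
    then show ?thesis
      using b(1) assms(3,4) by (metis add.right_neutral linear_add)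
  qed
  then obtain b where b: "\<And>j. b j \<in> span B" "\<And>i j. \<phi> i (b j) = (if i = j then 1 else 0)"
    using dual by metis
  have "inj b"
    by (rule injI) (metis b(2) zero_neq_one)
  have "independent (range b)"
    unfolding dependent_def
  proof clarify
    \<comment> \<open>\<open>\<phi> j\<close> vanishes on every other \<open>b i\<close>, hence on
      their span, but not at \<open>b j\<close>.\<close>
    fix j assume "b j \<in> span (range b - {b j})"
    then have "\<phi> j (b j) = 0"
      by (rule linear_eq_0_on_span[OF assms(3), rotated]) (use b(2) in auto)
    then show False
      by (simp add: b(2))
  qed
  then have "finite (range b)"
    using independent_span_bound[OF B(1)] b(1) by blast
  then show False
    using \<open>inj b\<close> finite_imageD infinite_UNIV_nat by blast
qed

text \<open>A basic neighbourhood restricts values on a finite \<open>F\<close> only. By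
  \<open>lift\<close>, these values are determined, up to a correction from the common kernel, by
  finitely many \<open>\<phi> j f\<close>. It is essential that \<open>k\<close> and
  \<open>e\<close> depend on \<open>F\<close> alone and not on \<open>f\<close>.\<close>

lemma open_map_Cp_powertop:
  fixes \<phi> :: "nat \<Rightarrow> ('a \<Rightarrow> real) \<Rightarrow> real"
  assumes lin: "\<And>k. linear (\<phi> k)"
    and lift: "\<And>F. finite F \<Longrightarrow> \<exists>k e. \<forall>f\<in>topspace (Cp X). \<exists>z\<in>topspace (Cp X). (\<forall>i. \<phi> i z = 0) \<and>
                 (\<forall>y\<in>F. f y - z y = (\<Sum>j<k. \<phi> j f * e j y))"
  shows "open_map (Cp X) (subtopology (powertop_real UNIV) ((\<lambda>f k. \<phi> k f) ` topspace (Cp X)))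
           (\<lambda>f k. \<phi> k f)"
proof -
  let ?T = "\<lambda>f k. \<phi> k f" and ?C = "topspace (Cp X)"
  have *: "\<exists>W. openin (powertop_real UNIV) W \<and> ?T f0 \<in> W \<and> W \<inter> ?T ` ?C \<subseteq> ?T ` V"
    if V: "openin (Cp X) V" and f0: "f0 \<in> V" for V f0
  proof -
    obtain V' where V': "openin (powertop_real UNIV) V'" "V = V' \<inter> ?C"
      using V by (auto simp: Cp_def openin_subtopology topspace_Cp[unfolded Cp_def])
    then obtain U where U: "finite {y. U y \<noteq> UNIV}" "\<And>y. open (U y)" "f0 \<in> Pi\<^sub>E UNIV U"
        "Pi\<^sub>E UNIV U \<subseteq> V'"
      using f0 by (auto simp: openin_product_topology_alt) 
    define F where "F = {y. U y \<noteq> UNIV}"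
    obtain k e where ke: "\<And>f. f \<in> ?C \<Longrightarrow> \<exists>z\<in>?C. (\<forall>i. \<phi> i z = 0) \<and>
        (\<forall>y\<in>F. f y - z y = (\<Sum>j<k. \<phi> j f * e j y))"
      using lift[of F] U(1) F_def by metis
    \<comment> \<open>The value at \<open>y\<close> predicted for a corrected preimage of
      \<open>s\<close>; it is affine in finitely many coordinates of \<open>s\<close>, hence
      continuous.\<close>
    define \<Psi> where "\<Psi> s y = f0 y + (\<Sum>j<k. (s j - \<phi> j f0) * e j y)" for s y
    define W where "W = (\<Inter>y\<in>F. {s. \<Psi> s y \<in> U y})"
    have "continuous_map (powertop_real UNIV) euclideanreal (\<lambda>s. \<Psi> s y)" for y
      unfolding \<Psi>_def by (intro continuous_intros continuous_map_product_projection) auto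
    then have "openin (powertop_real UNIV) {s. \<Psi> s y \<in> U y}" for y
      using U(2) openin_continuous_map_preimage by fastforce
    \<comment> \<open>The case of empty \<open>F\<close> is separate because the empty intersection
      is the whole space.\<close>
    then have "openin (powertop_real UNIV) W"
      using U(1) unfolding W_def F_def
      by (cases "{y. U y \<noteq> UNIV} = {}")
         (auto simp: openin_topspace[of "powertop_real UNIV", simplified])
    moreover have "?T f0 \<in> W"
      using U(3) by (auto simp: W_def \<Psi>_def PiE_iff)
    moreover have "?T f \<in> ?T ` V" if f: "f \<in> ?C" "?T f \<in> W" for f
    proof -
      have f0C: "f0 \<in> ?C"
        using f0 V'(2) by auto
      \<comment> \<open>Lifting \<open>f - f0\<close> instead of \<open>f\<close> gives the
        coefficients \<open>\<phi> j f - \<phi> j f0\<close>, so that \<open>f - z\<close> is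
        compared with \<open>f0\<close> on \<open>F\<close>.\<close>
      obtain z where z: "z \<in> ?C" "\<And>i. \<phi> i z = 0"
          "\<And>y. y \<in> F \<Longrightarrow> (f - f0) y - z y = (\<Sum>j<k. \<phi> j (f - f0) * e j y)"
        using ke[of "f - f0"] subspace_diff[OF subspace_topspace_Cp f(1) f0C] by blast
      have "f y - z y = \<Psi> (?T f) y" if "y \<in> F" for y
        using z(3)[OF that] by (simp add: \<Psi>_def linear_diff[OF lin])
      then have "(f - z) y \<in> U y" for y
        using f(2) by (cases "y \<in> F") (auto simp: W_def F_def)
      then have "f - z \<in> V"
        using U(4) V'(2) subspace_diff[OF subspace_topspace_Cp f(1) z(1)] by (auto simp: PiE_iff)
      moreover have "?T (f - z) = ?T f"
        by (simp add: linear_diff[OF lin] z(2))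
      ultimately show ?thesis
        by (metis image_eqI)
    qed
    ultimately show ?thesis by blast
  qed
  show ?thesis
    unfolding open_map_def
  proof (intro allI impI)
    fix V assume V: "openin (Cp X) V"
    have "V \<subseteq> ?C"
      using V openin_subset by blast
    show "openin (subtopology (powertop_real UNIV) (?T ` ?C)) (?T ` V)"
    proof (subst openin_subopen, intro ballI)
      fix s assume "s \<in> ?T ` V"
      then obtain f0 where f0: "f0 \<in> V" "s = ?T f0"
        by blast
      obtain W where W: "openin (powertop_real UNIV) W" "?T f0 \<in> W" "W \<inter> ?T ` ?C \<subseteq> ?T ` V"
        using *[OF V f0(1)] by blast
      have "?T f0 \<in> W \<inter> ?T ` ?C"
        using W(2) f0(1) \<open>V \<subseteq> ?C\<close> by blast
      then show "\<exists>T. openin (subtopology (powertop_real UNIV) (?T ` ?C)) T \<and> s \<in> T \<and> T \<subseteq> ?T ` V"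
        using W(3) f0(2) openin_subtopology_Int[OF W(1)] by (intro exI[of _ "W \<inter> ?T ` ?C"]) auto
    qed
  qed
qed

text \<open>The open continuous map \<open>?T\<close> is a quotient map onto its image
  \<open>R\<close>. It factors through the cosets by \<open>g\<close>, which is injective since the
  fibres of \<open>?T\<close> are exactly the cosets of \<open>Z\<close>. So the quotient is
  homeomorphic to \<open>R\<close>, a subspace of a countable product of lines.\<close>

lemma metrizable_quotient_Cp:
  fixes \<phi> :: "nat \<Rightarrow> ('a \<Rightarrow> real) \<Rightarrow> real"
  assumes lin: "\<And>k. linear (\<phi> k)" and cont: "\<And>k. continuous_map (Cp X) euclideanreal (\<phi> k)"
    and lift: "\<And>F. finite F \<Longrightarrow> \<exists>k e. \<forall>f\<in>topspace (Cp X). \<exists>z\<in>topspace (Cp X). (\<forall>i. \<phi> i z = 0) \<and>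
                 (\<forall>y\<in>F. f y - z y = (\<Sum>j<k. \<phi> j f * e j y))"
  shows "metrizable_space (quotient_topology (Cp X) {f \<in> topspace (Cp X). \<forall>k. \<phi> k f = 0})"
proof -
  let ?T = "\<lambda>f k. \<phi> k f" and ?C = "topspace (Cp X)"
  define Z where "Z = {f \<in> ?C. \<forall>k. \<phi> k f = 0}"
  define R where "R = subtopology (powertop_real UNIV) (?T ` ?C)"
  define g where "g A = ?T (SOME f. f \<in> A)" for A
  have "0 \<in> Z"
    by (simp add: Z_def linear_0[OF lin] subspace_0 subspace_topspace_Cp)
  have g: "g (vcoset Z f) = ?T f" for f
  proof -
    have "f + 0 \<in> vcoset Z f"
      unfolding vcoset_def using \<open>0 \<in> Z\<close> by blast
    then have "(SOME h. h \<in> vcoset Z f) \<in> vcoset Z f"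
      by (metis someI)
    then show ?thesis
      by (auto simp: g_def vcoset_def Z_def linear_add[OF lin])
  qed
  have topR: "topspace R = ?T ` ?C"
    by (auto simp: R_def)
  have "continuous_map (Cp X) R ?T"
    unfolding R_def using cont by (auto simp: continuous_map_in_subtopology continuous_map_componentwise_UNIV)
  moreover have "open_map (Cp X) R ?T"
    unfolding R_def using lin lift by (rule open_map_Cp_powertop)
  ultimately have q: "quotient_map (Cp X) R ?T"
    using topR by (intro continuous_open_imp_quotient_map) auto
  have qv: "quotient_map (Cp X) (quotient_topology (Cp X) Z) (vcoset Z)"
    by (rule quotient_map_quotient_topology)
  have "g \<circ> vcoset Z = ?T"
    by (auto simp: g)
  then have "quotient_map (quotient_topology (Cp X) Z) R g"
    using q qv quotient_map_compose_eq by metis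
  moreover have "inj_on g (topspace (quotient_topology (Cp X) Z))"
  proof (clarsimp simp: inj_on_def quotient_set_def g)
    fix f h assume fh: "f \<in> ?C" "h \<in> ?C" "?T f = ?T h"
    have *: "vcoset Z f \<subseteq> vcoset Z h" if "f \<in> ?C" "h \<in> ?C" "?T f = ?T h" for f h
    proof
      fix x assume "x \<in> vcoset Z f"
      then obtain z where z: "z \<in> Z" "x = f + z"
        by (auto simp: vcoset_def)
      have "f - h + z \<in> Z"
        using that z(1) by (auto simp: Z_def linear_add[OF lin] linear_diff[OF lin] fun_eq_iff
            intro!: subspace_add[OF subspace_topspace_Cp] subspace_diff[OF subspace_topspace_Cp])
      moreover have "x = h + (f - h + z)"
        by (simp add: z(2))
      ultimately show "x \<in> vcoset Z h"
        unfolding vcoset_def by blast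
    qed
    show "vcoset Z f = vcoset Z h"
      using *[OF fh] *[OF fh(2,1)] fh(3) by simp
  qed
  ultimately have "quotient_topology (Cp X) Z homeomorphic_space R"
    unfolding homeomorphic_space homeomorphic_map_def by blast
  moreover have "metrizable_space R"
    unfolding R_def
    by (intro metrizable_space_subtopology)
       (simp add: metrizable_space_product_topology metrizable_space_euclidean)
  ultimately show ?thesis
    using homeomorphic_metrizable_space Z_def by metis
qed

section \<open>Iterated copies and interpolation\<close>

text \<open>A Tietze extension from \<open>A\<close> is multiplied by a Urysohn function that is 1
  on \<open>A\<close> and 0 on \<open>B\<close>.\<close>

lemma Cp_extension:
  assumes "completely_regular_space X" "Hausdorff_space X"
    and "compactin X A" "compactin X B" "disjnt A B"
    and "continuous_map (subtopology X A) euclideanreal \<phi>"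
  obtains f where "f \<in> topspace (Cp X)" "\<And>x. x \<in> A \<Longrightarrow> f x = \<phi> x" "\<And>x. x \<in> B \<Longrightarrow> f x = 0"
proof -
  obtain g where g: "continuous_map X euclideanreal g" "\<And>x. x \<in> A \<Longrightarrow> g x = \<phi> x"
    by (rule Tietze_extension_completely_regular[OF assms(1,3) is_interval_univ _ assms(6)]) auto
  have "closedin X B"
    using assms(2,4) compactin_imp_closedin by blast
  then obtain u where u: "continuous_map X euclideanreal u" "u ` B \<subseteq> {0}" "u ` A \<subseteq> {1}"
    using Urysohn_completely_regular_compact_closed_alt assms(1,3,5) by blast
  define f where "f x = (if x \<in> topspace X then u x * g x else 0)" for x
  have "continuous_map X euclideanreal (\<lambda>x. u x * g x)"
    using u(1) g(1) by (rule continuous_map_real_mult)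
  then have "f \<in> topspace (Cp X)"
    by (auto simp: topspace_Cp f_def intro: continuous_map_eq)
  moreover have "f x = \<phi> x" if "x \<in> A" for x
    using that u(3) g(2) compactin_subset_topspace[OF assms(3)] by (auto simp: f_def)
  moreover have "f x = 0" if "x \<in> B" for x
    using that u(2) by (auto simp: f_def)
  ultimately show thesis
    by (rule that)
qed

lemma sum_lessThan_add:
  fixes f :: "nat \<Rightarrow> 'b::comm_monoid_add"
  shows "sum f {..<m + n} = sum f {..<m} + (\<Sum>i<n. f (m + i))"
  by (induction n) (auto simp: add.assoc)

text \<open>Continuity and injectivity make \<open>a n\<close> and \<open>b n\<close> embeddings,
  since they map a compact space into a Hausdorff one.\<close>

locale binary_copies =
  fixes X :: "'a topology" and K :: "nat \<Rightarrow> 'a set" and a b :: "nat \<Rightarrow> 'a \<Rightarrow> 'a"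
  assumes completely_regular: "completely_regular_space X" and Hausdorff: "Hausdorff_space X"
    and compactin_K: "\<And>n. compactin X (K n)"
    and continuous_a: "\<And>n. continuous_map (subtopology X (K (Suc n))) (subtopology X (K n)) (a n)"
    and continuous_b: "\<And>n. continuous_map (subtopology X (K (Suc n))) (subtopology X (K n)) (b n)"
    and inj_a: "\<And>n. inj_on (a n) (K (Suc n))" and inj_b: "\<And>n. inj_on (b n) (K (Suc n))"
    and disjoint: "\<And>n. a n ` K (Suc n) \<inter> b n ` K (Suc n) = {}"
begin

lemma K_subset: "K n \<subseteq> topspace X"
  by (rule compactin_subset_topspace[OF compactin_K])

lemma a_in: "x \<in> K (Suc n) \<Longrightarrow> a n x \<in> K n" and b_in: "x \<in> K (Suc n) \<Longrightarrow> b n x \<in> K n"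
  using continuous_a[of n] continuous_b[of n] K_subset[of "Suc n"]
  by (auto simp: continuous_map_def Pi_iff)

text \<open>For \<open>i < 2 ^ n\<close> the binary digits of \<open>i\<close> encode the choices
  between \<open>a\<close> and \<open>b\<close>. The top digit selects the map applied first, so
  each copy of level \<open>Suc n\<close> lies inside the copy of level \<open>n\<close> given by
  the lower digits.\<close>

primrec copy :: "nat \<Rightarrow> nat \<Rightarrow> 'a \<Rightarrow> 'a" where
  "copy 0 i = id"
| "copy (Suc n) i = (if i < 2 ^ n then copy n i \<circ> a n else copy n (i - 2 ^ n) \<circ> b n)"

lemma continuous_copy: "i < 2 ^ n \<Longrightarrow> continuous_map (subtopology X (K n)) X (copy n i)"
proof (induction n arbitrary: i)
  case (Suc n)
  then show ?case
    using continuous_map_compose[OF continuous_a[of n] Suc.IH[of i]]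
      continuous_map_compose[OF continuous_b[of n] Suc.IH[of "i - 2 ^ n"]] by auto
qed (simp add: continuous_map_from_subtopology)

lemma copy_in_topspace:
  assumes "i < 2 ^ n" "x \<in> K n"
  shows "copy n i x \<in> topspace X"
  using continuous_map_funspace[OF continuous_copy[OF assms(1)]] assms(2) K_subset[of n] by auto

text \<open>Compare the top digits of \<open>i\<close> and \<open>j\<close>. If they differ, the
  induction hypothesis identifies a value of \<open>a n\<close> with one of \<open>b n\<close>,
  against disjointness; if they agree, injectivity of \<open>a n\<close> or \<open>b n\<close>
  finishes.\<close>

lemma copy_eqD:
  "copy n i x = copy n j y \<Longrightarrow> i < 2 ^ n \<Longrightarrow> j < 2 ^ n \<Longrightarrow> x \<in> K n \<Longrightarrow> y \<in> K n \<Longrightarrow> i = j \<and> x = y"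
proof (induction n arbitrary: i j x y)
  case (Suc n)
  have *: "a n x \<in> K n" "a n y \<in> K n" "b n x \<in> K n" "b n y \<in> K n"
    using Suc.prems a_in b_in by auto
  have ab: "a n x \<noteq> b n y" "a n y \<noteq> b n x"
    using disjoint[of n] Suc.prems(4,5) by blast+
  have aa: "a n x = a n y \<Longrightarrow> x = y" "b n x = b n y \<Longrightarrow> x = y"
    using inj_a[of n] inj_b[of n] Suc.prems(4,5) by (auto dest: inj_onD)
  have lt: "\<not> i < 2 ^ n \<Longrightarrow> i - 2 ^ n < 2 ^ n" "\<not> j < 2 ^ n \<Longrightarrow> j - 2 ^ n < 2 ^ n"
    using Suc.prems(2,3) by auto
  consider "i < 2 ^ n" "j < 2 ^ n" | "i < 2 ^ n" "\<not> j < 2 ^ n"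
    | "\<not> i < 2 ^ n" "j < 2 ^ n" | "\<not> i < 2 ^ n" "\<not> j < 2 ^ n"
    by blast
  then show ?case
  proof cases
    case 1
    then show ?thesis
      using Suc.IH[of i "a n x" j "a n y"] Suc.prems(1) * aa by auto
  next
    case 2
    then show ?thesis
      using Suc.IH[of i "a n x" "j - 2 ^ n" "b n y"] Suc.prems(1) * ab lt by auto
  next
    case 3
    then show ?thesis
      using Suc.IH[of "i - 2 ^ n" "b n x" j "a n y"] Suc.prems(1) * ab lt by auto
  next
    case 4
    then show ?thesis
      using Suc.IH[of "i - 2 ^ n" "b n x" "j - 2 ^ n" "b n y"] Suc.prems(1) * aa lt
      by (auto simp: not_less)
  qed
qed simp

lemma inj_on_copy: "i < 2 ^ n \<Longrightarrow> inj_on (copy n i) (K n)"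
  by (rule inj_onI) (drule copy_eqD, simp_all)

lemma inj_on_copy_index: "x \<in> K n \<Longrightarrow> inj_on (\<lambda>i. copy n i x) {..<2 ^ n}"
  by (rule inj_onI) (drule copy_eqD, simp_all)

lemma compactin_copy: "i < 2 ^ n \<Longrightarrow> compactin X (copy n i ` K n)"
  using image_compactin[OF _ continuous_copy] compactin_K by (simp add: compactin_subtopology)

lemma compactin_copies_Un_finite:
  assumes "J \<subseteq> {..<2 ^ n}" "finite S" "S \<subseteq> topspace X"
  shows "compactin X ((\<Union>i\<in>J. copy n i ` K n) \<union> S)"
proof (rule compactin_Un)
  show "compactin X (\<Union>i\<in>J. copy n i ` K n)"
    using assms(1) finite_subset[OF assms(1)] by (intro compactin_Union) (auto intro: compactin_copy)
  show "compactin X S"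
    using assms(2,3) by (rule finite_imp_compactin[rotated])
qed

section \<open>Sums over the copies, and interpolation with vanishing sums\<close>

definition copy_sum :: "nat \<Rightarrow> ('a \<Rightarrow> real) \<Rightarrow> 'a \<Rightarrow> real" where
  "copy_sum n f x = (\<Sum>i<2 ^ n. f (copy n i x))"

lemma copy_sum_Suc: "copy_sum (Suc n) f x = copy_sum n f (a n x) + copy_sum n f (b n x)"
  using sum_lessThan_add[of "\<lambda>i. f (copy (Suc n) i x)" "2 ^ n" "2 ^ n"]
  by (simp add: copy_sum_def mult_2)

text \<open>Each sum at level \<open>Suc m\<close> is a sum of two sums at level \<open>m\<close>.
  One condition at level \<open>n\<close> thus controls all later functionals at once.\<close>

lemma copy_sum_zero_mono:
  assumes "n \<le> m" "\<And>x. x \<in> K n \<Longrightarrow> copy_sum n f x = 0" "x \<in> K m"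
  shows "copy_sum m f x = 0"
  using assms(1,3)
proof (induction arbitrary: x rule: dec_induct)
  case base
  then show ?case
    by (rule assms(2))
next
  case (step m)
  then show ?case
    by (simp add: copy_sum_Suc a_in b_in)
qed

text \<open>Transport \<open>g\<close> to the copy \<open>t\<close> by the inverse of
  \<open>copy n t\<close>, continuous by compactness of \<open>K n\<close>, and extend by zero on
  the other copies; one summand of the copy sum survives.\<close>

lemma Cp_supported_on_copy:
  assumes g: "continuous_map X euclideanreal g" and t: "t < 2 ^ n" and S: "finite S" "S \<subseteq> topspace X"
  obtains f where "f \<in> topspace (Cp X)" "\<And>x. x \<in> K n \<Longrightarrow> f (copy n t x) = g x"
    "\<And>x. x \<in> K n \<Longrightarrow> copy_sum n f x = g x" "\<And>y. y \<in> S - copy n t ` K n \<Longrightarrow> f y = 0"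
proof -
  define A where "A = copy n t ` K n"
  define B where "B = (\<Union>i\<in>{..<2 ^ n} - {t}. copy n i ` K n) \<union> (S - A)"
  have inj: "inj_on (copy n t) (K n)"
    using t by (rule inj_on_copy)
  have B: "compactin X B"
    unfolding B_def using S by (intro compactin_copies_Un_finite) auto
  have AB: "disjnt A B"
    unfolding A_def B_def disjnt_def using copy_eqD t by blast
  have "continuous_map (subtopology X A) (subtopology X (K n)) (inv_into (K n) (copy n t))"
    unfolding A_def
    by (rule continuous_inverse_map[OF _ Hausdorff continuous_copy[OF t]])
       (use K_subset[of n] inj in \<open>auto simp: compact_space_subtopology compactin_K Int_absorb1\<close>)
  then have cont: "continuous_map (subtopology X A) euclideanreal (g \<circ> inv_into (K n) (copy n t))"
    by (rule continuous_map_compose[OF _ continuous_map_from_subtopology[OF g]])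
  obtain f where f: "f \<in> topspace (Cp X)"
      "\<And>y. y \<in> A \<Longrightarrow> f y = (g \<circ> inv_into (K n) (copy n t)) y" "\<And>y. y \<in> B \<Longrightarrow> f y = 0"
    using Cp_extension[OF completely_regular Hausdorff compactin_copy[OF t, folded A_def] B AB cont]
    by blast
  have val: "f (copy n t x) = g x" if "x \<in> K n" for x
    using f(2)[of "copy n t x"] that inj by (simp add: A_def)
  moreover have "copy_sum n f x = g x" if "x \<in> K n" for x
  proof -
    have "copy_sum n f x = (\<Sum>i\<in>{t}. f (copy n i x))"
      unfolding copy_sum_def using t
      by (intro sum.mono_neutral_right ballI f(3)) (use that in \<open>auto simp: B_def\<close>)
    then show ?thesis
      using val that by simp
  qed
  ultimately show thesis
    using that f(1,3) by (simp add: A_def B_def)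
qed

text \<open>If \<open>y\<close> is the point over \<open>x0\<close> in the copy \<open>t\<close>, then one of the \<open>2 ^ n\<close> points over \<open>x0\<close> is outside
  \<open>S\<close>, in a copy \<open>s\<close> say; the same bump on the copies \<open>t\<close> and \<open>s\<close> with opposite signs does it.\<close>

lemma Cp_point_interpolation:
  assumes S: "finite S" "S \<subseteq> topspace X" "card S < 2 ^ n" and y: "y \<in> S"
  obtains f where "f \<in> topspace (Cp X)" "f y = 1" "\<And>x. x \<in> S - {y} \<Longrightarrow> f x = 0"
    "\<And>x. x \<in> K n \<Longrightarrow> copy_sum n f x = 0"
proof (cases "\<exists>t<2 ^ n. \<exists>x\<in>K n. y = copy n t x")
  case False
  \<comment> \<open>If \<open>y\<close> lies in no copy, a function vanishing on all copies will
    do.\<close>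
  define C where "C = (\<Union>i<2 ^ n. copy n i ` K n)"
  have "compactin X (C \<union> (S - {y}))"
    unfolding C_def using S by (intro compactin_copies_Un_finite) auto
  moreover have "disjnt {y} (C \<union> (S - {y}))"
    using False by (auto simp: C_def)
  moreover have "compactin X {y}"
    using S(2) y by auto
  ultimately obtain f where f: "f \<in> topspace (Cp X)" "\<And>x. x \<in> {y} \<Longrightarrow> f x = 1"
      "\<And>x. x \<in> C \<union> (S - {y}) \<Longrightarrow> f x = 0"
    using Cp_extension[OF completely_regular Hausdorff, of "{y}" "C \<union> (S - {y})" "\<lambda>_. 1"]
    by (metis continuous_map_const UNIV_I topspace_euclidean)
  show thesis
    by (rule that[OF f(1)]) (use f(2,3) in \<open>auto simp: copy_sum_def C_def intro!: sum.neutral\<close>)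
next
  case True
  then obtain t x0 where t: "t < 2 ^ n" and x0: "x0 \<in> K n" and yt: "y = copy n t x0"
    by blast
  have "card ((\<lambda>i. copy n i x0) ` {..<2 ^ n}) = 2 ^ n"
    by (simp add: card_image inj_on_copy_index[OF x0])
  then have "\<not> (\<lambda>i. copy n i x0) ` {..<2 ^ n} \<subseteq> S"
    using S(1,3) card_mono by (metis not_le)
  then obtain s where s: "s < 2 ^ n" "copy n s x0 \<notin> S"
    by blast
  have ts: "copy n t x \<notin> copy n s ` K n" if "x \<in> K n" for x
    using copy_eqD s t y yt that by blast
  \<comment> \<open>Making the bump \<open>g\<close> vanish on \<open>P\<close> keeps both
    transported bumps zero at the points of \<open>S\<close> other than \<open>y\<close>.\<close>
  define P where "P = {x \<in> K n. x \<noteq> x0 \<and> (\<exists>i<2 ^ n. copy n i x \<in> S)}"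
  have "finite (copy n i -` S \<inter> K n)" if "i < 2 ^ n" for i
    using S(1) inj_on_copy[OF that] by (rule finite_vimage_IntI)
  then have "finite (\<Union>i<2 ^ n. copy n i -` S \<inter> K n)"
    by (intro finite_UN_I) auto
  then have "finite P"
    by (rule rev_finite_subset) (auto simp: P_def)
  then have "compactin X P"
    using K_subset[of n] by (intro finite_imp_compactin) (auto simp: P_def)
  moreover have "disjnt {x0} P" "compactin X {x0}"
    using x0 K_subset by (auto simp: P_def)
  ultimately obtain g where g: "g \<in> topspace (Cp X)" "\<And>x. x \<in> {x0} \<Longrightarrow> g x = 1"
      "\<And>x. x \<in> P \<Longrightarrow> g x = 0"
    using Cp_extension[OF completely_regular Hausdorff, of "{x0}" P "\<lambda>_. 1"]
    by (metis continuous_map_const UNIV_I topspace_euclidean)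
  have gc: "continuous_map X euclideanreal g"
    using g(1) by (simp add: topspace_Cp)
  obtain f1 where f1: "f1 \<in> topspace (Cp X)" "\<And>x. x \<in> K n \<Longrightarrow> f1 (copy n t x) = g x"
      "\<And>x. x \<in> K n \<Longrightarrow> copy_sum n f1 x = g x" "\<And>y. y \<in> S - copy n t ` K n \<Longrightarrow> f1 y = 0"
    using Cp_supported_on_copy[OF gc t S(1,2)] by blast
  obtain f2 where f2: "f2 \<in> topspace (Cp X)" "\<And>x. x \<in> K n \<Longrightarrow> f2 (copy n s x) = g x"
      "\<And>x. x \<in> K n \<Longrightarrow> copy_sum n f2 x = g x" "\<And>y. y \<in> S - copy n s ` K n \<Longrightarrow> f2 y = 0"
    using Cp_supported_on_copy[OF gc s(1) S(1,2)] by blast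
  show thesis
  proof (rule that[of "f1 - f2"])
    show "f1 - f2 \<in> topspace (Cp X)"
      using subspace_diff[OF subspace_topspace_Cp] f1(1) f2(1) by blast
    show "(f1 - f2) y = 1"
      using f1(2)[OF x0] f2(4)[of y] ts[OF x0] y g(2) by (simp add: yt)
    show "copy_sum n (f1 - f2) x = 0" if "x \<in> K n" for x
      using f1(3)[OF that] f2(3)[OF that] by (simp add: copy_sum_def sum_subtractf)
    fix x assume x: "x \<in> S - {y}"
    have "f1 x = 0"
    proof (cases "x \<in> copy n t ` K n")
      case True
      then obtain x' where "x' \<in> K n" "x = copy n t x'"
        by blast
      then show ?thesis
        using f1(2) g(3)[of x'] x yt t by (auto simp: P_def)
    qed (use f1(4) x in blast)
    moreover have "f2 x = 0"
    proof (cases "x \<in> copy n s ` K n")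
      case True
      then obtain x' where "x' \<in> K n" "x = copy n s x'"
        by blast
      then show ?thesis
        using f2(2) g(3)[of x'] x s by (auto simp: P_def)
    qed (use f2(4) x in blast)
    ultimately show "(f1 - f2) x = 0"
      by simp
  qed
qed

text \<open>The functions from \<open>Cp_point_interpolation\<close> serve as a Lagrange basis, and
  vanishing copy sums are preserved by linear combinations.\<close>

lemma Cp_interpolation:
  assumes S: "finite S" "S \<subseteq> topspace X" "card S < 2 ^ n"
  obtains f where "f \<in> topspace (Cp X)" "\<And>x. x \<in> S \<Longrightarrow> f x = v x"
    "\<And>x. x \<in> K n \<Longrightarrow> copy_sum n f x = 0"
proof -
  have "\<exists>f. f \<in> topspace (Cp X) \<and> f y = 1 \<and> (\<forall>x\<in>S - {y}. f x = 0) \<and> (\<forall>x\<in>K n. copy_sum n f x = 0)"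
    if "y \<in> S" for y
    using Cp_point_interpolation[OF S that] by metis
  then obtain p where p: "\<And>y. y \<in> S \<Longrightarrow> p y \<in> topspace (Cp X)" "\<And>y. y \<in> S \<Longrightarrow> p y y = 1"
      "\<And>x y. y \<in> S \<Longrightarrow> x \<in> S - {y} \<Longrightarrow> p y x = 0"
      "\<And>x y. y \<in> S \<Longrightarrow> x \<in> K n \<Longrightarrow> copy_sum n (p y) x = 0"
    by metis
  define f where "f x = (\<Sum>y\<in>S. v y * p y x)" for x
  have "f \<in> topspace (Cp X)"
    using p(1) unfolding topspace_Cp f_def
    by (auto intro!: continuous_map_sum S(1) continuous_map_real_mult_left sum.neutral)
  moreover have "f x = v x" if "x \<in> S" for x
  proof -
    have "f x = (\<Sum>y\<in>{x}. v y * p y x)"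
      unfolding f_def using that S(1) p(3) by (intro sum.mono_neutral_right) auto
    then show ?thesis
      using p(2)[OF that] by simp
  qed
  moreover have "copy_sum n f x = 0" if "x \<in> K n" for x
  proof -
    have "copy_sum n f x = (\<Sum>y\<in>S. v y * copy_sum n (p y) x)"
      unfolding f_def copy_sum_def sum_distrib_left by (rule sum.swap)
    then show ?thesis
      using p(4) that by simp
  qed
  ultimately show thesis
    by (rule that)
qed

end

section \<open>The quotient\<close>

text \<open>Used with \<open>c i\<close> equal to the sum of \<open>f\<close> over
  \<open>A i\<close>, so that the remainder is annihilated by the first \<open>k\<close>
  functionals.\<close>

lemma biorthogonal_reduction:
  fixes A :: "nat \<Rightarrow> 'a set" and e :: "nat \<Rightarrow> 'a \<Rightarrow> real"
  assumes "\<And>i j. (\<Sum>y\<in>A i. e j y) = (if i = j then 1 else 0)" "i < k"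
  shows "(\<Sum>y\<in>A i. f y - (\<Sum>j<k. c j * e j y)) = (\<Sum>y\<in>A i. f y) - c i"
proof -
  have "(\<Sum>y\<in>A i. \<Sum>j<k. c j * e j y) = (\<Sum>j<k. c j * (\<Sum>y\<in>A i. e j y))"
    by (subst sum.swap) (simp add: sum_distrib_left)
  also have "\<dots> = c i"
    using assms(2) by (simp add: assms(1) if_distrib cong: if_cong)
  finally show ?thesis
    by (simp add: sum_subtractf)
qed

context binary_copies
begin

theorem metrizable_infinite_dimensional_quotient:
  assumes "\<And>n. K n \<noteq> {}"
  shows "\<exists>Z. subspace Z \<and> closedin (Cp X) Z \<and> metrizable_space (quotient_topology (Cp X) Z) \<and>
             infinite_dimensional_quotient (topspace (Cp X)) Z"
proof -
  let ?C = "topspace (Cp X)"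
  have "\<exists>p. \<forall>n. p n \<in> K n"
    using assms by (intro choice) blast
  then obtain p where p: "\<And>n. p n \<in> K n"
    by blast
  \<comment> \<open>Only even levels are used: the sizes \<open>4 ^ j\<close> for
    \<open>j < k\<close> add up to less than a third of \<open>4 ^ k\<close>, while
    \<open>2 ^ j\<close> would leave room for a single extra point.\<close>
  define A where "A k = (\<lambda>i. copy (2 * k) i (p (2 * k))) ` {..<2 ^ (2 * k)}" for k
  define \<phi> where "\<phi> k f = (\<Sum>y\<in>A k. f y)" for k and f :: "'a \<Rightarrow> real"
  have inj: "inj_on (\<lambda>i. copy (2 * k) i (p (2 * k))) {..<2 ^ (2 * k)}" for k
    using p by (rule inj_on_copy_index)
  have finA: "finite (A k)" for k
    by (simp add: A_def)
  have cardA: "card (A k) = 4 ^ k" for k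
    unfolding A_def card_image[OF inj] by (simp add: power_mult)
  have A_sub: "A k \<subseteq> topspace X" for k
    unfolding A_def using copy_in_topspace[OF _ p] by auto
  have \<phi>_copy_sum: "\<phi> k f = copy_sum (2 * k) f (p (2 * k))" for k f
    by (simp add: \<phi>_def A_def copy_sum_def sum.reindex[OF inj])
  have \<phi>_vanish: "\<phi> j f = 0" if "k \<le> j" "\<And>x. x \<in> K (2 * k) \<Longrightarrow> copy_sum (2 * k) f x = 0" for j k f
    using copy_sum_zero_mono[OF _ that(2) p, of "2 * j"] that(1) by (simp add: \<phi>_copy_sum)
  have lin: "linear (\<phi> k)" for k
    by (rule linearI) (simp_all add: \<phi>_def sum.distrib scaleR_fun_def sum_distrib_left)
  have cont: "continuous_map (Cp X) euclideanreal (\<phi> k)" for k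
    unfolding \<phi>_def Cp_def
    by (intro continuous_map_sum finA continuous_map_from_subtopology continuous_map_product_projection)
       simp
  define U where "U k = (\<Union>j<k. A j)" for k
  have U_Suc: "U (Suc k) = A k \<union> U k" for k
    by (auto simp: U_def less_Suc_eq)
  have finU: "finite (U k)" and U_sub: "U k \<subseteq> topspace X" for k
    using finA A_sub by (auto simp: U_def)
  \<comment> \<open>The factor 3 closes the induction:
    \<open>3 * 4 ^ k + 4 ^ k = 4 ^ Suc k\<close>.\<close>
  have cardU: "3 * card (U k) < 4 ^ k" for k
  proof (induction k)
    case (Suc k)
    then show ?case
      using card_Un_le[of "A k" "U k"] by (simp add: U_Suc cardA)
  qed (simp add: U_def)
  have "\<exists>e\<in>?C. \<forall>i. \<phi> i e = (if i = j then 1 else 0)" for j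
  proof -
    have "\<not> A j \<subseteq> U j"
      using card_mono[OF finU, of "A j" j] cardU[of j] by (auto simp: cardA)
    then obtain y where y: "y \<in> A j" "y \<notin> U j"
      by blast
    have "card (U (Suc j)) < 2 ^ (2 * Suc j)"
      using cardU[of "Suc j"] by (simp add: power_mult)
    \<comment> \<open>Prescribing the indicator of \<open>y\<close> on \<open>U (Suc j)\<close>
      settles \<open>\<phi> i\<close> for \<open>i \<le> j\<close>, as \<open>y\<close> is in
      \<open>A j\<close> but in no earlier \<open>A i\<close>; vanishing sums at level
      \<open>2 * Suc j\<close> settle \<open>i > j\<close>.\<close>
    then obtain e where e: "e \<in> ?C" "\<And>x. x \<in> U (Suc j) \<Longrightarrow> e x = (if x = y then 1 else 0)"
        "\<And>x. x \<in> K (2 * Suc j) \<Longrightarrow> copy_sum (2 * Suc j) e x = 0"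
      using Cp_interpolation[OF finU U_sub, where v = "\<lambda>x. if x = y then 1 else 0"] by metis
    have "\<phi> i e = (if i = j then 1 else 0)" for i
    proof (cases "i \<le> j")
      case True
      then have "\<phi> i e = (\<Sum>x\<in>A i. if x = y then 1 else 0)"
        unfolding \<phi>_def by (intro sum.cong refl e(2)) (auto simp: U_def)
      also have "\<dots> = (if y \<in> A i then 1 else 0)"
        by (simp add: finA)
      finally show ?thesis
        using y True by (auto simp: U_def)
    next
      case False
      then show ?thesis
        using \<phi>_vanish[of "Suc j" i e] e(3) by simp
    qed
    then show ?thesis
      using e(1) by blast
  qed
  then obtain e where e: "\<And>j. e j \<in> ?C" and dual: "\<And>i j. \<phi> i (e j) = (if i = j then 1 else 0)"
    by metis
  have lift: "\<exists>k e. \<forall>f\<in>?C. \<exists>z\<in>?C. (\<forall>i. \<phi> i z = 0) \<and>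
                 (\<forall>y\<in>F. f y - z y = (\<Sum>j<k. \<phi> j f * e j y))"
    if "finite F" for F
  proof (intro exI ballI)
    fix f assume f: "f \<in> ?C"
    \<comment> \<open>This \<open>k\<close> depends on \<open>F\<close> only. It suffices since
      \<open>card F < 4 ^ card F\<close> and \<open>U k\<close> has fewer than
      \<open>4 ^ k / 3\<close> points, so \<open>S\<close> has fewer than
      \<open>4 ^ k\<close>.\<close>
    define k where "k = Suc (card F)"
    \<comment> \<open>The remainder \<open>r\<close> has zero sum over \<open>A i\<close> for
      \<open>i < k\<close>. Copying it on \<open>S\<close> makes the first \<open>k\<close>
      functionals vanish at \<open>z\<close>; the later ones vanish by the copy sums.\<close>
    define r where "r y = f y - (\<Sum>j<k. \<phi> j f * e j y)" for y
    define S where "S = F \<inter> topspace X \<union> U k"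
    have "card F < 4 ^ card F"
      by (rule less_exp[THEN less_le_trans]) (rule power_mono, auto)
    moreover have "card S \<le> card F + card (U k)"
      unfolding S_def using card_Un_le card_mono[OF \<open>finite F\<close>, of "F \<inter> topspace X"]
      by (meson Int_lower1 add_le_mono1 order_trans)
    ultimately have "card S < 2 ^ (2 * k)"
      using cardU[of k] by (simp add: power_mult k_def)
    moreover have "finite S" "S \<subseteq> topspace X"
      using \<open>finite F\<close> finU U_sub by (auto simp: S_def)
    ultimately obtain z where z: "z \<in> ?C" "\<And>x. x \<in> S \<Longrightarrow> z x = r x"
        "\<And>x. x \<in> K (2 * k) \<Longrightarrow> copy_sum (2 * k) z x = 0"
      using Cp_interpolation[of S "2 * k" r] by metis
    have "\<phi> i z = 0" for i
    proof (cases "i < k")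
      case True
      then have "\<phi> i z = (\<Sum>y\<in>A i. r y)"
        unfolding \<phi>_def by (intro sum.cong refl z(2)) (auto simp: S_def U_def)
      then show ?thesis
        unfolding r_def
        using biorthogonal_reduction[where A = A and e = e and i = i and k = k and f = f
            and c = "\<lambda>j. \<phi> j f"] dual True
        by (simp add: \<phi>_def)
    qed (use \<phi>_vanish[of k i z] z(3) in auto)
    moreover have "f y - z y = (\<Sum>j<k. \<phi> j f * e j y)" if "y \<in> F" for y
    proof (cases "y \<in> topspace X")
      case True
      then show ?thesis
        using z(2)[of y] that by (simp add: S_def r_def)
    next
      case False
      then have "f y = 0" "z y = 0" "\<And>j. e j y = 0"
        using f z(1) e by (auto simp: topspace_Cp)
      then show ?thesis
        by simp
    qed
    ultimately show "\<exists>z\<in>?C. (\<forall>i. \<phi> i z = 0) \<and> (\<forall>y\<in>F. f y - z y = (\<Sum>j<Suc (card F). \<phi> j f * e j y))"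
      using z(1) unfolding k_def by blast
  qed
  define Z where "Z = {f \<in> ?C. \<forall>k. \<phi> k f = 0}"
  have "subspace Z"
    using subspace_topspace_Cp[of X]
    by (auto simp: Z_def subspace_def linear_0[OF lin] linear_add[OF lin] linear_scale[OF lin])
  moreover have "closedin (Cp X) Z"
  proof -
    have "closedin (Cp X) {f \<in> ?C. \<phi> k f \<in> {0}}" for k
      by (rule closedin_continuous_map_preimage[OF cont]) simp
    then have "closedin (Cp X) (\<Inter>k. {f \<in> ?C. \<phi> k f \<in> {0}})"
      by (intro closedin_INT) auto
    then show ?thesis
      by (rule back_subst) (auto simp: Z_def)
  qed
  moreover have "metrizable_space (quotient_topology (Cp X) Z)"
    unfolding Z_def using lin cont lift by (rule metrizable_quotient_Cp)
  moreover have "infinite_dimensional_quotient ?C Z"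
  proof (rule infinite_dimensional_quotientI[OF subspace_topspace_Cp \<open>subspace Z\<close> lin])
    show "\<phi> k z = 0" if "z \<in> Z" for k z
      using that by (simp add: Z_def)
  qed (use e dual in auto)
  ultimately show ?thesis
    by blast
qed

end

section \<open>From disjoint topological copies to sequences of embeddings\<close>

lemma binary_copies_exist:
  assumes "completely_regular_space X" "Hausdorff_space X" "\<And>n. compactin X (K n)"
    and "\<And>n. \<exists>A B. A \<subseteq> K n \<and> B \<subseteq> K n \<and> A \<inter> B = {} \<and>
                   subtopology X A homeomorphic_space subtopology X (K (Suc n)) \<and>
                   subtopology X B homeomorphic_space subtopology X (K (Suc n))"
  obtains a b where "binary_copies X K a b"
proof -
  have sub: "K n \<subseteq> topspace X" for n
    by (rule compactin_subset_topspace[OF assms(3)])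
  have embed: "\<exists>f. continuous_map (subtopology X L) (subtopology X M) f \<and> inj_on f L \<and> f ` L = A"
    if "subtopology X A homeomorphic_space subtopology X L" "A \<subseteq> M" "M \<subseteq> topspace X" "L \<subseteq> topspace X"
    for A L M
  proof -
    have "subtopology X L homeomorphic_space subtopology X A"
      using that(1) by (rule homeomorphic_space_sym[THEN iffD1])
    then obtain f where f: "homeomorphic_map (subtopology X L) (subtopology X A) f"
      unfolding homeomorphic_space by blast
    have "continuous_map (subtopology X L) (subtopology X A) f"
      using f by (rule homeomorphic_imp_continuous_map)
    then have "continuous_map (subtopology X L) (subtopology X M) f"
      using that(2) by (auto simp: continuous_map_in_subtopology)
    moreover have "inj_on f L" "f ` L = A"
      using homeomorphic_imp_injective_map[OF f] homeomorphic_imp_surjective_map[OF f] that(2-4)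
      by (simp_all add: Int_absorb1 order_trans[OF that(2,3)])
    ultimately show ?thesis
      by blast
  qed
  have "\<exists>a b. continuous_map (subtopology X (K (Suc n))) (subtopology X (K n)) a \<and>
              continuous_map (subtopology X (K (Suc n))) (subtopology X (K n)) b \<and>
              inj_on a (K (Suc n)) \<and> inj_on b (K (Suc n)) \<and> a ` K (Suc n) \<inter> b ` K (Suc n) = {}" for n
  proof -
    obtain A B where AB: "A \<subseteq> K n" "B \<subseteq> K n" "A \<inter> B = {}"
        "subtopology X A homeomorphic_space subtopology X (K (Suc n))"
        "subtopology X B homeomorphic_space subtopology X (K (Suc n))"
      using assms(4)[of n] by blast
    show ?thesis
      using embed[OF AB(4,1) sub sub] embed[OF AB(5,2) sub sub] AB(3) by metis
  qed
  then obtain a b where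
    "\<And>n. continuous_map (subtopology X (K (Suc n))) (subtopology X (K n)) (a n) \<and>
         continuous_map (subtopology X (K (Suc n))) (subtopology X (K n)) (b n) \<and>
         inj_on (a n) (K (Suc n)) \<and> inj_on (b n) (K (Suc n)) \<and> a n ` K (Suc n) \<inter> b n ` K (Suc n) = {}"
    by metis
  then have "binary_copies X K a b"
    using assms(1-3) by unfold_locales auto
  then show thesis
    by (rule that)
qed

theorem theorem2:
  fixes X :: "'a topology" and K :: "nat \<Rightarrow> 'a set"
  assumes "completely_regular_space X" and "Hausdorff_space X"
    and "\<And>n. compactin X (K n)" and "\<And>n. K n \<noteq> {}"
    and "\<And>n. \<exists>A B. A \<subseteq> K n \<and> B \<subseteq> K n \<and> A \<inter> B = {} \<and>
                   subtopology X A homeomorphic_space subtopology X (K (Suc n)) \<and>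
                   subtopology X B homeomorphic_space subtopology X (K (Suc n))"
  shows "\<exists>Z. subspace Z \<and> closedin (Cp X) Z \<and>
             metrizable_space (quotient_topology (Cp X) Z) \<and>
             infinite_dimensional_quotient (topspace (Cp X)) Z"
proof -
  obtain a b where "binary_copies X K a b"
    by (rule binary_copies_exist[where X = X and K = K, OF assms(1-3,5)])
  then show ?thesis
    using assms(4) by (rule binary_copies.metrizable_infinite_dimensional_quotient)
qed

end
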